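(* Let $\Phi=\{\phi(\cdot,b):b\in[\underline b,\overline b]\}$ and $\Psi=\{\psi(\cdot,b):b\in[\underline b,\overline b]\}$ be two families of securities, each satisfying Assumptions 2, 3 and 4 of the context, in the auction model of the context, and suppose that $\Phi$ is steeper than $\Psi$. Assume that $X_1$ is positively dependent on $(Y_1,Z_1)$ in the monotone likelihood ratio (MLR) sense. Then the second price auction with bids restricted to $\Phi$ generates at least as much expected revenue for the seller as the second price auction with bids restricted to $\Psi$, i.e. $$\mathbb{E}\big[\phi(X_1,s(Z_1,Z_1;\Phi))\,\big|\,Y_1>Z_1\big]\;\ge\;\mathbb{E}\big[\psi(X_1,s(Z_1,Z_1;\Psi))\,\big|\,Y_1>Z_1\big].$$
   Context: Throughout, "increasing"/"decreasing" mean strictly so; all expectations and conditional expectations that appear are assumed to exist and be finite; conditional distributions given $Y_1=y_1,Z_1=z_1$ refer to a fixed version of the regular conditional distribution, and "for any $y_1,z_1$" means for all values in $[\underline y,\overline y]$. Model. There are $N\ge 2$ buyers. Buyer $n$'s value is a nonnegative random variable $X_n$ whose set of possible values is the interval $[\underline x,\overline x]$, and his signal is a random variable $Y_n$ with values in $[\underline y,\overline y]$; $\mathbf Y=(Y_1,\dots,Y_N)$ has a joint pdf that is positive on $[\underline y,\overline y]^N$. Assumption 1 (symmetry): the joint CDF of $(X_n,Y_n,\mathbf Y_{-n})$ is identical for each $n$ and symmetric in its last $N-1$ arguments (the coordinates of $\mathbf{y}_{-n}$). Put $Z_1=\max\{Y_2,\dots,Y_N\}$. The winner must invest a fixed amount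 $I\in\mathbb R$. All buyers have the same utility function $u:\mathbb R\to\mathbb R$, concave (possibly linear), increasing, with $u(0)=0$. It is assumed that $\mathbb E[u(X_1-I)\mid Y_1=y_1,Z_1=z_1]>0$ for all $y_1,z_1$. The seller is risk neutral. A family of securities is $\Phi=\{\phi(\cdot,b):b\in[\underline b,\overline b]\}$, where $\phi(x,b)\in\mathbb R$ is the payment to the seller when the winner's value is $x$ and the security is $b$. Assumption 2: for any $b$, $\phi(x,b)$ is continuous and nondecreasing in $x$, and $x-\phi(x,b)$ is nondecreasing and nonconstant in $x$. Assumption 3: for any $y_1,z_1$: (i) $\mathbb E[u(X_1-I-\phi(X_1,b))\mid Y_1=y_1,Z_1=z_1]$ is continuous and decreasing in $b$, nonnegative at $b=\underline b$, nonpositive at $b=\overline b$; (ii) $\mathbb E[\phi(X_1,b)\mid Y_1=y_1,Z_1=z_1]$ is continuous and increasing in $b$. Define $s(y_1,z_1;\Phi)$ as the unique $b\in[\underline b,\overline b]$ with $\mathbb E[u(X_1-I-\phi(X_1,b))\mid Y_1=y_1,Z_1=z_1]=0$. Assumption 4: $s(y_1,z_1;\Phi)$ is increasing in $y_1$. Second price auction with bids restricted to $\Phi$: each buyer submits $b\in[\underline b,\overline b]$, the highest bidder wins and pays $\phi(x,b')$, where $x$ is the realized value of the winner and $b'$ is the second highest bid. In the symmetric equilibrium buyer $n$ bids $s(y_n,y_n;\Phi)$, and the seller's expected revenue is $\mathbb E[\phi(X_1,s(Z_1,Z_1;\Phi))\mid Y_1>Z_1]$. MLR: for any $y_1,z_1$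 the conditional pdf $f_{X_1\mid Y_1=y_1,Z_1=z_1}$ exists and is positive everywhere on $[\underline x,\overline x]$, and $f_{X_1\mid Y_1=y_1,Z_1=z_1}(x_1)/f_{X_1\mid Y_1=\hat y_1,Z_1=\hat z_1}(x_1)$ is nondecreasing in $x_1$ whenever $y_1\ge\hat y_1$ and $z_1\ge\hat z_1$. A function $g(w)$ is quasi-monotone if for any $\hat w<w$, $g(\hat w)>0$ implies $g(w)\ge 0$. $\Phi$ is steeper than $\Psi$ if for any $b',\hat b\in[\underline b,\overline b]$ the function $w\mapsto\phi(w,b')-\psi(w,\hat b)$ is quasi-monotone on $[\underline x,\overline x]$. *)

theory Defs
  imports "HOL-Probability.Probability"
begin

section \<open>Conditional distributions\<close>

abbreviation borel_Icc :: "real \<Rightarrow> real \<Rightarrow> real measure" where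
  "borel_Icc a b \<equiv> restrict_space borel {a..b}"

abbreviation lborel_Icc :: "real \<Rightarrow> real \<Rightarrow> real measure" where
  "lborel_Icc a b \<equiv> restrict_space lborel {a..b}"

text \<open>\<open>K\<close> is a (version of the) regular conditional distribution of \<open>V\<close>, with values in \<open>A\<close>,
  given \<open>W\<close>, with values in \<open>B\<close>.\<close>

definition regular_cond_distr ::
  "'a measure \<Rightarrow> 'b measure \<Rightarrow> ('a \<Rightarrow> 'b) \<Rightarrow> 'c measure \<Rightarrow> ('a \<Rightarrow> 'c) \<Rightarrow> ('c \<Rightarrow> 'b measure) \<Rightarrow> bool"
where
  "regular_cond_distr M A V B W K \<longleftrightarrow>
     K \<in> B \<rightarrow>\<^sub>M prob_algebra A \<and>
     (\<forall>S\<in>sets A. \<forall>T\<in>sets B.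
        emeasure M {\<omega>\<in>space M. V \<omega> \<in> S \<and> W \<omega> \<in> T} =
        (\<integral>\<^sup>+w\<in>T. emeasure (K w) S \<partial>distr M B W))"

section \<open>The auction environment\<close>

text \<open>Buyers are \<open>1, \<dots>, N\<close>. \<open>rival n k\<close> is the buyer whose signal is the \<open>k\<close>-th coordinate of
  \<open>Y\<^sub>-\<^sub>n = (Y\<^sub>1, \<dots>, Y\<^sub>n\<^sub>-\<^sub>1, Y\<^sub>n\<^sub>+\<^sub>1, \<dots>, Y\<^sub>N)\<close>.\<close>

definition rival :: "nat \<Rightarrow> nat \<Rightarrow> nat" where
  "rival n k = (if k < n then k else k + 1)"

definition joint_cdf ::
  "'a measure \<Rightarrow> nat \<Rightarrow> (nat \<Rightarrow> 'a \<Rightarrow> real) \<Rightarrow> (nat \<Rightarrow> 'a \<Rightarrow> real) \<Rightarrow> nat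
    \<Rightarrow> real \<Rightarrow> real \<Rightarrow> (nat \<Rightarrow> real) \<Rightarrow> real"
where
  "joint_cdf M N X Y n x y v =
     measure M {\<omega>\<in>space M. X n \<omega> \<le> x \<and> Y n \<omega> \<le> y \<and> (\<forall>k\<in>{1..N - 1}. Y (rival n k) \<omega> \<le> v k)}"

definition symmetric_model ::
  "'a measure \<Rightarrow> nat \<Rightarrow> (nat \<Rightarrow> 'a \<Rightarrow> real) \<Rightarrow> (nat \<Rightarrow> 'a \<Rightarrow> real) \<Rightarrow> bool"
where
  "symmetric_model M N X Y \<longleftrightarrow>
     (\<forall>n\<in>{1..N}. \<forall>x y v. joint_cdf M N X Y n x y v = joint_cdf M N X Y 1 x y v) \<and>
     (\<forall>n\<in>{1..N}. \<forall>x y v \<pi>. \<pi> permutes {1..N - 1} \<longrightarrow>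
        joint_cdf M N X Y n x y (v \<circ> \<pi>) = joint_cdf M N X Y n x y v)"

definition Z1 :: "nat \<Rightarrow> (nat \<Rightarrow> 'a \<Rightarrow> real) \<Rightarrow> 'a \<Rightarrow> real" where
  "Z1 N Y \<omega> = (MAX n\<in>{2..N}. Y n \<omega>)"

text \<open>\<open>K (y, z)\<close> is the fixed version of the conditional distribution of \<open>X 1\<close> given
  \<open>Y 1 = y\<close> and \<open>Z1 N Y = z\<close>. It is a measure on \<open>{xl..xh}\<close>, not on the whole real line.\<close>

locale auction_model = prob_space M for M :: "'a measure" +
  fixes N :: nat
    and X Y :: "nat \<Rightarrow> 'a \<Rightarrow> real"
    and K :: "real \<times> real \<Rightarrow> real measure"
    and xl xh yl yh :: real
    and u :: "real \<Rightarrow> real"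
    and I :: real
  assumes two_buyers: "N \<ge> 2"
    and value_bounds: "0 \<le> xl" "xl \<le> xh"
    and signal_bounds: "yl \<le> yh"
    and value_rv: "\<And>n. n \<in> {1..N} \<Longrightarrow> X n \<in> M \<rightarrow>\<^sub>M borel_Icc xl xh"
    and value_support:
      "\<And>n x e. \<lbrakk>n \<in> {1..N}; x \<in> {xl..xh}; e > 0\<rbrakk>
         \<Longrightarrow> measure M {\<omega>\<in>space M. \<bar>X n \<omega> - x\<bar> < e} > 0"
    and signal_rv: "\<And>n. n \<in> {1..N} \<Longrightarrow> Y n \<in> M \<rightarrow>\<^sub>M borel_Icc yl yh"
    and signal_pdf:
      "\<exists>g :: (nat \<Rightarrow> real) \<Rightarrow> real.
         distributed M (\<Pi>\<^sub>M n\<in>{1..N}. lborel_Icc yl yh) (\<lambda>\<omega>. \<lambda>n\<in>{1..N}. Y n \<omega>) (\<lambda>y. ennreal (g y)) \<and>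
         (\<forall>y \<in> (\<Pi>\<^sub>E n\<in>{1..N}. {yl..yh}). g y > 0)"
    and symmetry: "symmetric_model M N X Y"
    and cond_distr:
      "regular_cond_distr M (borel_Icc xl xh) (X 1)
         (borel_Icc yl yh \<Otimes>\<^sub>M borel_Icc yl yh) (\<lambda>\<omega>. (Y 1 \<omega>, Z1 N Y \<omega>)) K"
    and utility: "concave_on UNIV u" "strict_mono u" "u 0 = 0"
    and project_valuable:
      "\<And>y z. \<lbrakk>y \<in> {yl..yh}; z \<in> {yl..yh}\<rbrakk>
         \<Longrightarrow> integrable (K (y, z)) (\<lambda>x. u (x - I)) \<and> (\<integral>x. u (x - I) \<partial>K (y, z)) > 0"

section \<open>Families of securities\<close>

text \<open>A family is a function \<open>\<phi>\<close> with \<open>\<phi> x b\<close> the payment at value \<open>x \<in> {xl..xh}\<close> under the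
  security \<open>b \<in> {bl..bh}\<close>; its values elsewhere are irrelevant.\<close>

definition security_shape ::
  "real \<Rightarrow> real \<Rightarrow> real \<Rightarrow> real \<Rightarrow> (real \<Rightarrow> real \<Rightarrow> real) \<Rightarrow> bool"
where
  "security_shape xl xh bl bh \<phi> \<longleftrightarrow>
     (\<forall>b\<in>{bl..bh}.
        continuous_on {xl..xh} (\<lambda>x. \<phi> x b) \<and>
        mono_on {xl..xh} (\<lambda>x. \<phi> x b) \<and>
        mono_on {xl..xh} (\<lambda>x. x - \<phi> x b) \<and>
        \<not> (\<lambda>x. x - \<phi> x b) constant_on {xl..xh})"

definition winner_utility ::
  "(real \<times> real \<Rightarrow> real measure) \<Rightarrow> (real \<Rightarrow> real) \<Rightarrow> real \<Rightarrow> (real \<Rightarrow> real \<Rightarrow> real)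
    \<Rightarrow> real \<Rightarrow> real \<Rightarrow> real \<Rightarrow> real"
where
  "winner_utility K u I \<phi> y z b = (\<integral>x. u (x - I - \<phi> x b) \<partial>K (y, z))"

definition security_ordering ::
  "(real \<times> real \<Rightarrow> real measure) \<Rightarrow> (real \<Rightarrow> real) \<Rightarrow> real \<Rightarrow> real \<Rightarrow> real \<Rightarrow> real \<Rightarrow> real
    \<Rightarrow> (real \<Rightarrow> real \<Rightarrow> real) \<Rightarrow> bool"
where
  "security_ordering K u I yl yh bl bh \<phi> \<longleftrightarrow>
     (\<forall>y\<in>{yl..yh}. \<forall>z\<in>{yl..yh}.
        (\<forall>b\<in>{bl..bh}. integrable (K (y, z)) (\<lambda>x. u (x - I - \<phi> x b)) \<and>
                       integrable (K (y, z)) (\<lambda>x. \<phi> x b)) \<and>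
        continuous_on {bl..bh} (winner_utility K u I \<phi> y z) \<and>
        strict_antimono_on {bl..bh} (winner_utility K u I \<phi> y z) \<and>
        winner_utility K u I \<phi> y z bl \<ge> 0 \<and>
        winner_utility K u I \<phi> y z bh \<le> 0 \<and>
        continuous_on {bl..bh} (\<lambda>b. \<integral>x. \<phi> x b \<partial>K (y, z)) \<and>
        strict_mono_on {bl..bh} (\<lambda>b. \<integral>x. \<phi> x b \<partial>K (y, z)))"

definition s ::
  "(real \<times> real \<Rightarrow> real measure) \<Rightarrow> (real \<Rightarrow> real) \<Rightarrow> real \<Rightarrow> real \<Rightarrow> real
    \<Rightarrow> (real \<Rightarrow> real \<Rightarrow> real) \<Rightarrow> real \<Rightarrow> real \<Rightarrow> real"
where
  "s K u I bl bh \<phi> y z = (THE b. b \<in> {bl..bh} \<and> winner_utility K u I \<phi> y z b = 0)"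

definition s_increasing ::
  "(real \<times> real \<Rightarrow> real measure) \<Rightarrow> (real \<Rightarrow> real) \<Rightarrow> real \<Rightarrow> real \<Rightarrow> real \<Rightarrow> real \<Rightarrow> real
    \<Rightarrow> (real \<Rightarrow> real \<Rightarrow> real) \<Rightarrow> bool"
where
  "s_increasing K u I yl yh bl bh \<phi> \<longleftrightarrow>
     (\<forall>z\<in>{yl..yh}. strict_mono_on {yl..yh} (\<lambda>y. s K u I bl bh \<phi> y z))"

definition quasi_mono_on :: "real set \<Rightarrow> (real \<Rightarrow> real) \<Rightarrow> bool" where
  "quasi_mono_on S g \<longleftrightarrow> (\<forall>v\<in>S. \<forall>w\<in>S. v < w \<longrightarrow> g v > 0 \<longrightarrow> g w \<ge> 0)"

definition steeper ::
  "real \<Rightarrow> real \<Rightarrow> real \<Rightarrow> real \<Rightarrow> (real \<Rightarrow> real \<Rightarrow> real) \<Rightarrow> (real \<Rightarrow> real \<Rightarrow> real) \<Rightarrow> bool"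
where
  "steeper xl xh bl bh \<phi> \<psi> \<longleftrightarrow>
     (\<forall>b\<in>{bl..bh}. \<forall>c\<in>{bl..bh}. quasi_mono_on {xl..xh} (\<lambda>w. \<phi> w b - \<psi> w c))"

section \<open>Monotone likelihood ratio\<close>

definition mlr_dependent ::
  "(real \<times> real \<Rightarrow> real measure) \<Rightarrow> real \<Rightarrow> real \<Rightarrow> real \<Rightarrow> real \<Rightarrow> bool"
where
  "mlr_dependent K xl xh yl yh \<longleftrightarrow>
     (\<exists>f :: real \<Rightarrow> real \<Rightarrow> real \<Rightarrow> real.
        (\<forall>y\<in>{yl..yh}. \<forall>z\<in>{yl..yh}.
           f y z \<in> borel_measurable (borel_Icc xl xh) \<and>
           (\<forall>x\<in>{xl..xh}. f y z x > 0) \<and>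
           K (y, z) = density (lborel_Icc xl xh) (\<lambda>x. ennreal (f y z x))) \<and>
        (\<forall>y\<in>{yl..yh}. \<forall>z\<in>{yl..yh}. \<forall>y'\<in>{yl..yh}. \<forall>z'\<in>{yl..yh}. y' \<le> y \<longrightarrow> z' \<le> z \<longrightarrow>
           mono_on {xl..xh} (\<lambda>x. f y z x / f y' z' x)))"

section \<open>Revenue of the second price auction\<close>

text \<open>Conditional expectation given the event \<open>Y 1 > Z1 N Y\<close> is integration with respect to
  \<open>uniform_measure M\<close> of that event.\<close>

definition buyer1_wins :: "'a measure \<Rightarrow> nat \<Rightarrow> (nat \<Rightarrow> 'a \<Rightarrow> real) \<Rightarrow> 'a set" where
  "buyer1_wins M N Y = {\<omega>\<in>space M. Y 1 \<omega> > Z1 N Y \<omega>}"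

definition expected_revenue ::
  "'a measure \<Rightarrow> nat \<Rightarrow> (nat \<Rightarrow> 'a \<Rightarrow> real) \<Rightarrow> (nat \<Rightarrow> 'a \<Rightarrow> real)
    \<Rightarrow> (real \<times> real \<Rightarrow> real measure) \<Rightarrow> (real \<Rightarrow> real) \<Rightarrow> real \<Rightarrow> real \<Rightarrow> real
    \<Rightarrow> (real \<Rightarrow> real \<Rightarrow> real) \<Rightarrow> real"
where
  "expected_revenue M N X Y K u I bl bh \<phi> =
     (\<integral>\<omega>. \<phi> (X 1 \<omega>) (s K u I bl bh \<phi> (Z1 N Y \<omega>) (Z1 N Y \<omega>)) \<partial>uniform_measure M (buyer1_wins M N Y))"

text \<open>The expectation exists and is finite. Integrability is required of the Borel function
  \<open>(x, z) \<mapsto> \<phi> x (s z z)\<close> under the conditional law of \<open>(X 1, Z1)\<close>, not merely of its composition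
  with \<open>(X 1, Z1)\<close> on \<open>M\<close>: since \<open>\<phi>\<close> need not be measurable in \<open>b\<close>, the latter would not make the
  expectation a functional of the joint distribution of values and signals.\<close>

definition revenue_exists ::
  "'a measure \<Rightarrow> nat \<Rightarrow> (nat \<Rightarrow> 'a \<Rightarrow> real) \<Rightarrow> (nat \<Rightarrow> 'a \<Rightarrow> real)
    \<Rightarrow> (real \<times> real \<Rightarrow> real measure) \<Rightarrow> real \<Rightarrow> real \<Rightarrow> real \<Rightarrow> real
    \<Rightarrow> (real \<Rightarrow> real) \<Rightarrow> real \<Rightarrow> real \<Rightarrow> real \<Rightarrow> (real \<Rightarrow> real \<Rightarrow> real) \<Rightarrow> bool"
where
  "revenue_exists M N X Y K xl xh yl yh u I bl bh \<phi> \<longleftrightarrow>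
     integrable
       (distr (uniform_measure M (buyer1_wins M N Y)) (borel_Icc xl xh \<Otimes>\<^sub>M borel_Icc yl yh)
          (\<lambda>\<omega>. (X 1 \<omega>, Z1 N Y \<omega>)))
       (\<lambda>(x, z). \<phi> x (s K u I bl bh \<phi> z z))"

end

theory Submission
  imports Defs
begin

text \<open>Condition on \<open>Y\<^sub>1 = y > z = Z\<^sub>1\<close> and let \<open>b = s(z, z; \<Phi>)\<close>, \<open>c = s(z, z; \<Psi>)\<close>. By steepness
  \<open>g = \<phi>(\<cdot>, b) - \<psi>(\<cdot>, c)\<close> changes sign once, from negative to positive, at some \<open>t\<close>. Since the
  net payoff under \<open>\<phi>(\<cdot>, b)\<close> is nondecreasing in the value, a supergradient \<open>k > 0\<close> of the concave \<open>u\<close> at the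
  payoff \<open>t - I - \<phi>(t, b)\<close> satisfies \<open>u(x - I - \<psi>(x, c)) - u(x - I - \<phi>(x, b)) \<le> k g(x)\<close>
  for every \<open>x\<close>. Given \<open>Y\<^sub>1 = Z\<^sub>1 = z\<close> the left-hand side has mean \<open>0\<close>, so \<open>g\<close> has
  nonnegative mean. Passing from \<open>(z, z)\<close> to \<open>(y, z)\<close> multiplies the density by a nondecreasing
  ratio, which preserves the nonnegativity of the mean of the single-crossing \<open>g\<close>.\<close>

text \<open>The crossing point is the infimum of the points where \<open>g\<close> is positive:
  below it no such point exists, and any \<open>x\<close> above it has one to its left, so
  quasi-monotonicity applies. If \<open>g\<close> is never positive, the right endpoint serves.
  Nothing is claimed about the sign of \<open>g\<close> at \<open>t\<close> itself.\<close>

lemma quasi_mono_on_single_crossing: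
  assumes g: "quasi_mono_on {a..b} g" and ab: "a \<le> b"
  obtains t where "t \<in> {a..b}"
    and "\<And>x. x \<in> {a..b} \<Longrightarrow> x < t \<Longrightarrow> g x \<le> 0"
    and "\<And>x. x \<in> {a..b} \<Longrightarrow> t < x \<Longrightarrow> g x \<ge> 0"
proof (cases "\<exists>v\<in>{a..b}. g v > 0")
  case False
  then show ?thesis
    using that[of b] ab by (force simp: not_less)
next
  case True
  define P where "P = {v \<in> {a..b}. g v > 0}"
  have ne: "P \<noteq> {}" and bdd: "bdd_below P" and sub: "P \<subseteq> {a..b}"
    using True by (auto simp: P_def intro: bdd_belowI[of _ a])
  show ?thesis
  proof (rule that[of "Inf P"])
    obtain v where v: "v \<in> P" using ne by auto
    have "Inf P \<le> v" using v bdd by (rule cInf_lower)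
    moreover have "a \<le> Inf P" using ne sub by (intro cInf_greatest) auto
    ultimately show "Inf P \<in> {a..b}" using v sub by auto
    show "g x \<le> 0" if "x \<in> {a..b}" "x < Inf P" for x
      using cInf_lower[OF _ bdd, of x] that by (force simp: P_def)
    show "g x \<ge> 0" if x: "x \<in> {a..b}" "Inf P < x" for x
    proof -
      obtain v where "v \<in> P" "v < x" using cInf_lessD[OF ne x(2)] by auto
      then show ?thesis using g[unfolded quasi_mono_on_def, rule_format, of v x] x sub by (auto simp: P_def)
    qed
  qed
qed

text \<open>A supergradient at \<open>p\<close> bounds the chords of \<open>u\<close> leading away
  from \<open>p\<close>: slopes are at most \<open>k\<close> on the right and at least
  \<open>k\<close> on the left. The three alternatives say that \<open>r\<close> lies beyond
  \<open>q\<close> as seen from \<open>p\<close>, or that \<open>q\<close> is \<open>p\<close>. One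
  \<open>k\<close> serves all \<open>q\<close> and \<open>r\<close>, so the bound can later be
  integrated.\<close>

lemma concave_slope_bound:
  fixes u :: "real \<Rightarrow> real"
  assumes conc: "concave_on UNIV u" and mono: "strict_mono u"
  obtains k where "k > 0"
    and "\<And>q r. \<lbrakk>p \<le> q \<and> q \<le> r \<or> r \<le> q \<and> q \<le> p \<or> q = p\<rbrakk> \<Longrightarrow> u r - u q \<le> k * (r - q)"
proof -
  define f where "f x = - u x" for x
  have f: "convex_on UNIV f"
    using conc by (simp add: concave_on_def f_def[abs_def])
  \<comment> \<open>This is the right derivative of \<open>u\<close> at \<open>p\<close>, written
    through the convex function \<open>f\<close>.\<close>
  define k where "k = - Inf ((\<lambda>t. (f p - f t) / (p - t)) ` ({p<..}))"
  have sup: "u r \<le> u p + k * (r - p)" for r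
    using convex_le_Inf_differential[OF f, of p r] by (simp add: k_def f_def algebra_simps)
  \<comment> \<open>Successive chords of a concave function have decreasing slopes; the denominators
    are cleared so that the cases below need only products.\<close>
  have slope: "(u z - u y) * (y - x) \<le> (u y - u x) * (z - y)" if "x < y" "y < z" for x y z
  proof -
    have "(f x - f y) / (x - y) \<le> (f y - f z) / (y - z)"
      using convex_on_slope_le[OF f, of x z y] that by (simp add: algebra_simps)
    then show ?thesis using that by (simp add: f_def field_simps)
  qed
  show ?thesis
  proof (rule that[of k])
    show "k > 0"
      using sup[of "p + 1"] strict_monoD[OF mono, of p "p + 1"] by simp
    fix q r assume "p \<le> q \<and> q \<le> r \<or> r \<le> q \<and> q \<le> p \<or> q = p"
    then consider "q = p" | "q = r" | "p < q" "q < r" | "r < q" "q < p" by linarith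
    then show "u r - u q \<le> k * (r - q)"
    proof cases
      case 1 then show ?thesis using sup[of r] by simp
    next
      case 2 then show ?thesis by simp
    next
      case 3
      have "(u r - u q) * (q - p) \<le> (u q - u p) * (r - q)" using slope[of p q r] 3 by simp
      also have "\<dots> \<le> (k * (q - p)) * (r - q)" using sup[of q] 3 by (intro mult_right_mono) auto
      finally have "(u r - u q) * (q - p) \<le> (k * (r - q)) * (q - p)" by (simp add: ac_simps)
      then show ?thesis using 3 by simp
    next
      case 4
      have "(k * (q - r)) * (p - q) = (k * (p - q)) * (q - r)" by simp
      also have "\<dots> \<le> (u p - u q) * (q - r)"
        using sup[of q] 4 by (intro mult_right_mono) (auto simp: algebra_simps)
      also have "\<dots> \<le> (u q - u r) * (p - q)" using slope[of r q p] 4 by simp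
      finally have "k * (q - r) \<le> u q - u r" using 4 by simp
      then show ?thesis by (simp add: algebra_simps)
    qed
  qed
qed

text \<open>Think of \<open>k\<close> as the likelihood ratio \<open>f1 / f0\<close> at the crossing
  point of \<open>g\<close>. When the ratio is monotone, its excess over \<open>k\<close> never has
  the sign opposite to \<open>g\<close>, which is the pointwise hypothesis; integrating it bounds
  the new mean below by \<open>k\<close> times the old one.\<close>

lemma integral_mlr_nonneg:
  fixes f0 f1 g :: "'a \<Rightarrow> real"
  assumes [measurable]: "f0 \<in> borel_measurable L" "f1 \<in> borel_measurable L" "g \<in> borel_measurable L"
    and f0: "\<And>x. x \<in> space L \<Longrightarrow> f0 x \<ge> 0" and f1: "\<And>x. x \<in> space L \<Longrightarrow> f1 x \<ge> 0"
    and int: "integrable (density L f0) g" "integrable (density L f1) g"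
    and k: "k \<ge> 0" "\<And>x. x \<in> space L \<Longrightarrow> k * (f0 x * g x) \<le> f1 x * g x"
    and nonneg: "(\<integral>x. g x \<partial>density L f0) \<ge> 0"
  shows "(\<integral>x. g x \<partial>density L f1) \<ge> 0"
proof -
  have ae: "AE x in L. 0 \<le> f0 x" "AE x in L. 0 \<le> f1 x" using f0 f1 by auto
  have int': "integrable L (\<lambda>x. f0 x * g x)" "integrable L (\<lambda>x. f1 x * g x)"
    using int ae by (simp_all add: integrable_real_density)
  have "0 \<le> k * (\<integral>x. f0 x * g x \<partial>L)"
    using nonneg ae k by (simp add: integral_real_density)
  also have "\<dots> \<le> (\<integral>x. f1 x * g x \<partial>L)"
    using int' k by (subst integral_mult_right_zero[symmetric], intro integral_mono) auto
  finally show ?thesis using ae by (simp add: integral_real_density)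
qed

text \<open>The definition of \<open>regular_cond_distr\<close> fixes only the probabilities of
  rectangles. These form an intersection-stable generator, so they determine the joint law of
  \<open>V\<close> and \<open>W\<close>, and the integral disintegrates for every measurable
  \<open>h\<close>.\<close>

lemma nn_integral_regular_cond_distr:
  assumes K: "regular_cond_distr M A V B W K"
    and [measurable]: "V \<in> M \<rightarrow>\<^sub>M A" "W \<in> M \<rightarrow>\<^sub>M B" "h \<in> borel_measurable (A \<Otimes>\<^sub>M B)"
    and M: "prob_space M"
  shows "(\<integral>\<^sup>+\<omega>. h (V \<omega>, W \<omega>) \<partial>M) = (\<integral>\<^sup>+w. (\<integral>\<^sup>+x. h (x, w) \<partial>K w) \<partial>distr M B W)"
proof -
  interpret prob_space M by fact
  have Kp[measurable]: "K \<in> B \<rightarrow>\<^sub>M prob_algebra A"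
    and Keq: "\<And>S T. S \<in> sets A \<Longrightarrow> T \<in> sets B \<Longrightarrow>
        emeasure M {\<omega>\<in>space M. V \<omega> \<in> S \<and> W \<omega> \<in> T} = (\<integral>\<^sup>+w\<in>T. emeasure (K w) S \<partial>distr M B W)"
    using K by (auto simp: regular_cond_distr_def)
  have Ks[measurable]: "K \<in> B \<rightarrow>\<^sub>M subprob_algebra A"
    using Kp by (rule measurable_prob_algebraD)
  \<comment> \<open>\<open>J w\<close> places the conditional law \<open>K w\<close> on the slice
    over \<open>w\<close>, so that binding the law of \<open>W\<close> with \<open>J\<close> is the
    candidate for the joint law.\<close>
  define J where "J w = distr (K w) (A \<Otimes>\<^sub>M B) (\<lambda>x. (x, w))" for w
  have J[measurable]: "J \<in> B \<rightarrow>\<^sub>M subprob_algebra (A \<Otimes>\<^sub>M B)"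
    unfolding J_def by (rule measurable_distr2[where M = A]) measurable
  \<comment> \<open>The facts about \<open>bind\<close> used below require a nonempty source
    space.\<close>
  have neB: "space B \<noteq> {}" using not_empty measurable_space[OF \<open>W \<in> M \<rightarrow>\<^sub>M B\<close>] by blast
  have Kw: "sets (K w) = sets A" if "w \<in> space B" for w
    using Ks that by (rule sets_kernel)
  have pair: "(\<lambda>x. (x, w)) \<in> K w \<rightarrow>\<^sub>M A \<Otimes>\<^sub>M B" if "w \<in> space B" for w
    using that by (subst measurable_cong_sets[OF Kw refl]) auto
  let ?E = "{S \<times> T |S T. S \<in> sets A \<and> T \<in> sets B}"
  have "distr M (A \<Otimes>\<^sub>M B) (\<lambda>\<omega>. (V \<omega>, W \<omega>)) = distr M B W \<bind> J"
  proof (rule measure_eqI_generator_eq[where E = ?E and \<Omega> = "space A \<times> space B"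
        and A = "\<lambda>_. space A \<times> space B"])
    show "Int_stable ?E" by (rule Int_stable_pair_measure_generator)
    show "?E \<subseteq> Pow (space A \<times> space B)" by (auto dest: sets.sets_into_space)
    show "sets (distr M (A \<Otimes>\<^sub>M B) (\<lambda>\<omega>. (V \<omega>, W \<omega>))) = sigma_sets (space A \<times> space B) ?E"
      by (simp add: sets_pair_measure)
    show "sets (distr M B W \<bind> J) = sigma_sets (space A \<times> space B) ?E"
      using neB by (subst sets_bind[where N = "A \<Otimes>\<^sub>M B"]) (auto simp: sets_pair_measure J_def)
    show "range (\<lambda>_::nat. space A \<times> space B) \<subseteq> ?E" by auto
    show "(\<Union>i::nat. space A \<times> space B) = space A \<times> space B" by simp
    show "emeasure (distr M (A \<Otimes>\<^sub>M B) (\<lambda>\<omega>. (V \<omega>, W \<omega>))) (space A \<times> space B) \<noteq> \<infinity>" for i :: nat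
      by (subst emeasure_distr) auto
    fix R assume "R \<in> ?E"
    then obtain S T where R: "R = S \<times> T" and [measurable]: "S \<in> sets A" "T \<in> sets B" by auto
    have "emeasure (distr M (A \<Otimes>\<^sub>M B) (\<lambda>\<omega>. (V \<omega>, W \<omega>))) R
        = emeasure M {\<omega>\<in>space M. V \<omega> \<in> S \<and> W \<omega> \<in> T}"
      unfolding R by (subst emeasure_distr) (auto intro!: arg_cong[where f = "emeasure M"])
    also have "\<dots> = (\<integral>\<^sup>+w\<in>T. emeasure (K w) S \<partial>distr M B W)"
      by (rule Keq) auto
    also have "\<dots> = (\<integral>\<^sup>+w. emeasure (J w) R \<partial>distr M B W)"
    proof (rule nn_integral_cong)
      fix w assume "w \<in> space (distr M B W)"
      then have w: "w \<in> space B" by simp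
      have "emeasure (J w) R = emeasure (K w) ((\<lambda>x. (x, w)) -` R \<inter> space (K w))"
        unfolding J_def R by (rule emeasure_distr[OF pair[OF w]]) auto
      also have "(\<lambda>x. (x, w)) -` R \<inter> space (K w) = (if w \<in> T then S else {})"
        using sets_eq_imp_space_eq[OF Kw[OF w]] sets.sets_into_space[of S A] by (auto simp: R)
      finally show "emeasure (K w) S * indicator T w = emeasure (J w) R" by auto
    qed
    also have "\<dots> = emeasure (distr M B W \<bind> J) R"
      using neB by (subst emeasure_bind[where N = "A \<Otimes>\<^sub>M B"]) (auto simp: R)
    finally show "emeasure (distr M (A \<Otimes>\<^sub>M B) (\<lambda>\<omega>. (V \<omega>, W \<omega>))) R = emeasure (distr M B W \<bind> J) R" .
  qed
  moreover have "(\<integral>\<^sup>+\<omega>. h (V \<omega>, W \<omega>) \<partial>M) = (\<integral>\<^sup>+r. h r \<partial>distr M (A \<Otimes>\<^sub>M B) (\<lambda>\<omega>. (V \<omega>, W \<omega>)))"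
    by (subst nn_integral_distr) auto
  moreover have "(\<integral>\<^sup>+r. h r \<partial>(distr M B W \<bind> J)) = (\<integral>\<^sup>+w. (\<integral>\<^sup>+r. h r \<partial>J w) \<partial>distr M B W)"
    by (rule nn_integral_bind[where B = "A \<Otimes>\<^sub>M B"]) auto
  moreover have "\<dots> = (\<integral>\<^sup>+w. (\<integral>\<^sup>+x. h (x, w) \<partial>K w) \<partial>distr M B W)"
    by (rule nn_integral_cong) (auto simp: J_def pair nn_integral_distr)
  ultimately show ?thesis by simp
qed

text \<open>Stating the sign of a mean through nonnegative integrals lets it pass through the
  disintegration above without a separate treatment of the integrability of the inner
  integrals.\<close>

lemma nn_integral_neg_part_le_iff:
  fixes g :: "'a \<Rightarrow> real"
  assumes "integrable M g"
  shows "(\<integral>\<^sup>+x. ennreal (- g x) \<partial>M) \<le> (\<integral>\<^sup>+x. ennreal (g x) \<partial>M) \<longleftrightarrow> (\<integral>x. g x \<partial>M) \<ge> 0"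
proof -
  have "(\<integral>\<^sup>+x. ennreal (g x) \<partial>M) \<noteq> \<infinity>" "(\<integral>\<^sup>+x. ennreal (- g x) \<partial>M) \<noteq> \<infinity>"
    using assms by (auto simp: real_integrable_def)
  then show ?thesis
    unfolding real_lebesgue_integral_def[OF assms]
    by (cases "\<integral>\<^sup>+x. ennreal (g x) \<partial>M"; cases "\<integral>\<^sup>+x. ennreal (- g x) \<partial>M")
      (auto simp: top_ennreal_def)
qed

text \<open>Existence comes from the intermediate value theorem and uniqueness from strict decrease
  in \<open>b\<close>, so the definite description in \<open>s\<close> denotes the break-even
  security.\<close>

lemma s_solves:
  assumes ord: "security_ordering K u I yl yh bl bh \<phi>" and bids: "bl \<le> bh"
    and yz: "y \<in> {yl..yh}" "z \<in> {yl..yh}"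
  shows "s K u I bl bh \<phi> y z \<in> {bl..bh}"
    and "winner_utility K u I \<phi> y z (s K u I bl bh \<phi> y z) = 0"
proof -
  let ?w = "winner_utility K u I \<phi> y z"
  have cont: "continuous_on {bl..bh} ?w" and anti: "strict_antimono_on {bl..bh} ?w"
    and ends: "?w bl \<ge> 0" "?w bh \<le> 0"
    using ord yz by (auto simp: security_ordering_def)
  obtain b where b: "b \<in> {bl..bh}" "?w b = 0"
    using IVT2'[of ?w bh 0 bl] cont ends bids by auto
  have "c = b" if "c \<in> {bl..bh}" "?w c = 0" for c
    using monotone_onD[OF anti b(1) that(1)] monotone_onD[OF anti that(1) b(1)] that(2) b(2)
    by (metis less_irrefl linorder_neqE)
  then have "s K u I bl bh \<phi> y z = b"
    unfolding s_def using b by (intro the_equality) blast+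
  with b show "s K u I bl bh \<phi> y z \<in> {bl..bh}" "?w (s K u I bl bh \<phi> y z) = 0" by simp_all
qed

lemma (in auction_model) Z1_measurable: "Z1 N Y \<in> M \<rightarrow>\<^sub>M borel_Icc yl yh"
proof (rule measurable_restrict_space2)
  have ne: "{2..N} \<noteq> {}" using two_buyers by auto
  have Yb: "Y n \<in> borel_measurable M" if "n \<in> {1..N}" for n
    using signal_rv[OF that] by (simp add: measurable_restrict_space2_iff)
  have Yr: "Y n \<omega> \<in> {yl..yh}" if "n \<in> {1..N}" "\<omega> \<in> space M" for n \<omega>
    using measurable_space[OF signal_rv[OF that(1)] that(2)] by (simp add: space_restrict_space)
  show "Z1 N Y \<in> space M \<rightarrow> {yl..yh}"
  proof
    fix \<omega> assume w: "\<omega> \<in> space M"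
    have "Z1 N Y \<omega> \<in> (\<lambda>n. Y n \<omega>) ` {2..N}"
      unfolding Z1_def using ne by (intro Max_in) auto
    then show "Z1 N Y \<omega> \<in> {yl..yh}" using Yr w by force
  qed
  show "Z1 N Y \<in> borel_measurable M"
    unfolding Z1_def[abs_def] using Yb ne by (intro borel_measurable_Max) auto
qed

text \<open>This is the revenue comparison at fixed signals. The price is set by a rival with signal
  \<open>z\<close>, who bids as if both signals were \<open>z\<close>; hence \<open>b\<close> and
  \<open>c\<close> are evaluated at \<open>(z, z)\<close>, whereas the payment is averaged at the
  signals \<open>(y, z)\<close> of the actual winner.\<close>

lemma expected_payment_le:
  assumes K: "\<And>w. w \<in> {yl..yh} \<times> {yl..yh} \<Longrightarrow> sets (K w) = sets (borel_Icc xl xh)"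
    and x: "xl \<le> xh" and bids: "bl \<le> bh"
    and u: "concave_on UNIV u" "strict_mono u"
    and \<phi>_shape: "security_shape xl xh bl bh \<phi>"
    and \<phi>_ord: "security_ordering K u I yl yh bl bh \<phi>"
    and \<psi>_ord: "security_ordering K u I yl yh bl bh \<psi>"
    and steeper: "steeper xl xh bl bh \<phi> \<psi>"
    and mlr: "mlr_dependent K xl xh yl yh"
    and yz: "y \<in> {yl..yh}" "z \<in> {yl..yh}" "z \<le> y"
  defines "b \<equiv> s K u I bl bh \<phi> z z" and "c \<equiv> s K u I bl bh \<psi> z z"
  shows "integrable (K (y, z)) (\<lambda>x. \<phi> x b - \<psi> x c)"
    and "(\<integral>x. \<phi> x b - \<psi> x c \<partial>K (y, z)) \<ge> 0"
proof -
  have b: "b \<in> {bl..bh}" "winner_utility K u I \<phi> z z b = 0"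
    and c: "c \<in> {bl..bh}" "winner_utility K u I \<psi> z z c = 0"
    unfolding b_def c_def
    by (rule s_solves[OF \<phi>_ord bids yz(2,2)] s_solves[OF \<psi>_ord bids yz(2,2)])+
  define g where "g x = \<phi> x b - \<psi> x c" for x
  define A where "A x = x - I - \<phi> x b" for x
  define B where "B x = x - I - \<psi> x c" for x
  have int: "integrable (K (y', z)) g" if "y' \<in> {yl..yh}" for y'
    unfolding g_def[abs_def] using \<phi>_ord \<psi>_ord b c yz that by (auto simp: security_ordering_def)
  have intA: "integrable (K (z, z)) (\<lambda>x. u (A x))" and intB: "integrable (K (z, z)) (\<lambda>x. u (B x))"
    unfolding A_def B_def using \<phi>_ord \<psi>_ord b c yz by (auto simp: security_ordering_def)
  have spK: "space (K (y', z)) = {xl..xh}" if "y' \<in> {yl..yh}" for y'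
    using sets_eq_imp_space_eq[OF K, of "(y', z)"] that yz by (simp add: space_restrict_space)
  have "mono_on {xl..xh} (\<lambda>x. x - \<phi> x b)"
    using \<phi>_shape b(1) by (simp add: security_shape_def)
  then have monoA: "A v \<le> A w" if "v \<in> {xl..xh}" "w \<in> {xl..xh}" "v \<le> w" for v w
    using mono_onD[of _ _ v w] that unfolding A_def by fastforce
  have "quasi_mono_on {xl..xh} g"
    unfolding g_def using steeper b c by (auto simp: steeper_def)
  then obtain t where t: "t \<in> {xl..xh}"
    and below: "\<And>x. x \<in> {xl..xh} \<Longrightarrow> x < t \<Longrightarrow> g x \<le> 0"
    and above: "\<And>x. x \<in> {xl..xh} \<Longrightarrow> t < x \<Longrightarrow> g x \<ge> 0"
    using quasi_mono_on_single_crossing x by metis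
  \<comment> \<open>\<open>A\<close> and \<open>B\<close> are the winner's net payoffs under the two
    securities, so the payment gap is the payoff gap with the roles exchanged.\<close>
  have gAB: "g x = B x - A x" for x by (simp add: g_def A_def B_def)
  obtain k where k: "k > 0" and slope:
    "\<And>q r. \<lbrakk>A t \<le> q \<and> q \<le> r \<or> r \<le> q \<and> q \<le> A t \<or> q = A t\<rbrakk> \<Longrightarrow> u r - u q \<le> k * (r - q)"
    using concave_slope_bound[OF u] by metis
  \<comment> \<open>The slope bound is anchored at \<open>A t\<close>. Left of \<open>t\<close> one
    has \<open>B x \<le> A x \<le> A t\<close>, right of \<open>t\<close> the reverse chain, and at
    \<open>t\<close> the points \<open>A x\<close> and \<open>A t\<close> coincide, so one
    alternative always applies.\<close>
  have diff: "u (B x) - u (A x) \<le> k * g x" if x: "x \<in> {xl..xh}" for x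
    unfolding gAB
  proof (rule slope, cases x t rule: linorder_cases)
    case less
    then show "A t \<le> A x \<and> A x \<le> B x \<or> B x \<le> A x \<and> A x \<le> A t \<or> A x = A t"
      using below[OF x] monoA[OF x t] gAB[of x] by simp
  next
    case greater
    then show "A t \<le> A x \<and> A x \<le> B x \<or> B x \<le> A x \<and> A x \<le> A t \<or> A x = A t"
      using above[OF x] monoA[OF t x] gAB[of x] by simp
  qed simp
  \<comment> \<open>Both securities make a buyer with signals \<open>(z, z)\<close> break even, so
    both expected utilities vanish.\<close>
  have "0 = (\<integral>x. u (B x) - u (A x) \<partial>K (z, z))"
    using intA intB b c by (simp add: winner_utility_def A_def B_def)
  also have "\<dots> \<le> (\<integral>x. k * g x \<partial>K (z, z))"
    using intA intB int[of z] yz diff spK[of z] by (intro integral_mono) auto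
  finally have nonneg: "(\<integral>x. g x \<partial>K (z, z)) \<ge> 0"
    using k by (simp add: zero_le_mult_iff)
  obtain f where
    f: "\<And>y z. y \<in> {yl..yh} \<Longrightarrow> z \<in> {yl..yh} \<Longrightarrow> f y z \<in> borel_measurable (borel_Icc xl xh) \<and>
           (\<forall>x\<in>{xl..xh}. f y z x > 0) \<and>
           K (y, z) = density (lborel_Icc xl xh) (\<lambda>x. ennreal (f y z x))"
    and ratio: "mono_on {xl..xh} (\<lambda>x. f y z x / f z z x)"
    using mlr yz unfolding mlr_dependent_def by blast
  let ?L = "lborel_Icc xl xh"
  have setsL: "sets ?L = sets (borel_Icc xl xh)"
    by (intro sets_restrict_space_cong) simp
  have measL: "f y' z \<in> borel_measurable ?L" if "y' \<in> {yl..yh}" for y'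
    using f[OF that yz(2)] measurable_cong_sets[OF setsL refl] by auto
  have gL: "g \<in> borel_measurable ?L"
    using borel_measurable_integrable[OF int[OF yz(1)]] K[of "(y, z)"] yz setsL
    by (simp cong: measurable_cong_sets)
  have spL: "space ?L = {xl..xh}" by (simp add: space_restrict_space)
  have "(\<integral>x. g x \<partial>density ?L (f y z)) \<ge> 0"
  \<comment> \<open>The constant is the likelihood ratio at the crossing point. Replacing it by the
    ratio at \<open>x\<close> lowers the factor where \<open>g\<close> is nonpositive and raises it
    where \<open>g\<close> is nonnegative, so the product with \<open>g\<close> never falls.\<close>
  proof (rule integral_mlr_nonneg[where ?f0.0 = "f z z" and k = "f y z t / f z z t"])
    show "f y z t / f z z t \<ge> 0" using f yz t by (simp add: less_imp_le)
    show "f y z t / f z z t * (f z z x * g x) \<le> f y z x * g x" if "x \<in> space ?L" for x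
    proof -
      have x: "x \<in> {xl..xh}" using that spL by simp
      have pos: "f z z x > 0" using f yz x by blast
      have "(f y z t / f z z t) * g x \<le> (f y z x / f z z x) * g x"
      proof (cases x t rule: linorder_cases)
        case less
        then show ?thesis
          using mono_onD[OF ratio x t] below[OF x] by (intro mult_right_mono_neg) auto
      next
        case greater
        then show ?thesis
          using mono_onD[OF ratio t x] above[OF x] by (intro mult_right_mono) auto
      qed simp
      then have "(f y z t / f z z t) * g x * f z z x \<le> (f y z x / f z z x) * g x * f z z x"
        using pos by (rule mult_right_mono[OF _ less_imp_le])
      then show ?thesis using pos by (simp add: ac_simps)
    qed
  qed (use f yz measL gL spL int[of y] int[of z] nonneg in \<open>auto simp: less_imp_le\<close>)
  then show "(\<integral>x. \<phi> x b - \<psi> x c \<partial>K (y, z)) \<ge> 0"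
    using f[OF yz(1,2)] by (simp add: g_def)
  show "integrable (K (y, z)) (\<lambda>x. \<phi> x b - \<psi> x c)"
    using int[OF yz(1)] by (simp add: g_def[abs_def])
qed

theorem proposition1:
  fixes M :: "'a measure" and N :: nat
    and X Y :: "nat \<Rightarrow> 'a \<Rightarrow> real"
    and K :: "real \<times> real \<Rightarrow> real measure"
    and xl xh yl yh bl bh I :: real
    and u :: "real \<Rightarrow> real"
    and \<phi> \<psi> :: "real \<Rightarrow> real \<Rightarrow> real"
  assumes model: "auction_model M N X Y K xl xh yl yh u I"
    and bids: "bl \<le> bh"
    and \<phi>_shape: "security_shape xl xh bl bh \<phi>"
    and \<phi>_ordering: "security_ordering K u I yl yh bl bh \<phi>"
    and \<phi>_increasing: "s_increasing K u I yl yh bl bh \<phi>"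
    and \<phi>_revenue: "revenue_exists M N X Y K xl xh yl yh u I bl bh \<phi>"
    and \<psi>_shape: "security_shape xl xh bl bh \<psi>"
    and \<psi>_ordering: "security_ordering K u I yl yh bl bh \<psi>"
    and \<psi>_increasing: "s_increasing K u I yl yh bl bh \<psi>"
    and \<psi>_revenue: "revenue_exists M N X Y K xl xh yl yh u I bl bh \<psi>"
    and steeper: "steeper xl xh bl bh \<phi> \<psi>"
    and mlr: "mlr_dependent K xl xh yl yh"
  shows "expected_revenue M N X Y K u I bl bh \<phi> \<ge> expected_revenue M N X Y K u I bl bh \<psi>"
proof -
  interpret auction_model M N X Y K xl xh yl yh u I by fact
  let ?A = "borel_Icc xl xh" and ?C = "borel_Icc yl yh"
  let ?U = "uniform_measure M (buyer1_wins M N Y)"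
  let ?W = "\<lambda>\<omega>. (Y 1 \<omega>, Z1 N Y \<omega>)"
  have X1[measurable]: "X 1 \<in> M \<rightarrow>\<^sub>M ?A" and Y1[measurable]: "Y 1 \<in> M \<rightarrow>\<^sub>M ?C"
    using value_rv signal_rv two_buyers by auto
  note Z1_measurable[measurable]
  have id[measurable]: "(\<lambda>x. x) \<in> borel_measurable ?C"
    by (intro measurable_restrict_space1) simp
  have W: "?W \<in> M \<rightarrow>\<^sub>M ?C \<Otimes>\<^sub>M ?C" by measurable
  have win[measurable]: "{w \<in> space (?C \<Otimes>\<^sub>M ?C). fst w > snd w} \<in> sets (?C \<Otimes>\<^sub>M ?C)"
    using measurable_compose[OF measurable_fst id] measurable_compose[OF measurable_snd id]
    by (intro borel_measurable_less)
  \<comment> \<open>Winning depends on the signals alone, so its indicator is constant under each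
    inner integral over \<open>K w\<close>.\<close>
  have wins: "buyer1_wins M N Y = ?W -` {w \<in> space (?C \<Otimes>\<^sub>M ?C). fst w > snd w} \<inter> space M"
    using measurable_space[OF W] by (auto simp: buyer1_wins_def)
  have E[measurable]: "buyer1_wins M N Y \<in> sets M"
    unfolding wins by (rule measurable_sets[OF W win])
  have spW: "space (?C \<Otimes>\<^sub>M ?C) = {yl..yh} \<times> {yl..yh}"
    by (simp add: space_pair_measure space_restrict_space)
  have Kp: "K \<in> ?C \<Otimes>\<^sub>M ?C \<rightarrow>\<^sub>M prob_algebra ?A"
    using cond_distr by (simp add: regular_cond_distr_def)
  have Ks: "sets (K w) = sets ?A" if "w \<in> {yl..yh} \<times> {yl..yh}" for w
    using sets_kernel[OF measurable_prob_algebraD[OF Kp]] that spW by simp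

  define p where "p r = \<phi> (fst r) (s K u I bl bh \<phi> (snd r) (snd r))" for r
  define q where "q r = \<psi> (fst r) (s K u I bl bh \<psi> (snd r) (snd r))" for r
  define h where "h r = p r - q r" for r
  let ?XZ = "\<lambda>\<omega>. (X 1 \<omega>, Z1 N Y \<omega>)"
  have XZ: "?XZ \<in> ?U \<rightarrow>\<^sub>M ?A \<Otimes>\<^sub>M ?C" by measurable
  have ip: "integrable (distr ?U (?A \<Otimes>\<^sub>M ?C) ?XZ) p" and iq: "integrable (distr ?U (?A \<Otimes>\<^sub>M ?C) ?XZ) q"
    using \<phi>_revenue \<psi>_revenue by (simp_all add: revenue_exists_def p_def[abs_def] q_def[abs_def] case_prod_beta')
  \<comment> \<open>Joint measurability of the payments is taken from the existence of the revenues
    under the law of \<open>(X 1, Z1)\<close>; the securities are not assumed measurable in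
    \<open>b\<close>.\<close>
  have [measurable]: "p \<in> borel_measurable (?A \<Otimes>\<^sub>M ?C)" "q \<in> borel_measurable (?A \<Otimes>\<^sub>M ?C)"
    using borel_measurable_integrable[OF ip] borel_measurable_integrable[OF iq] by simp_all
  have h[measurable]: "h \<in> borel_measurable (?A \<Otimes>\<^sub>M ?C)"
    unfolding h_def[abs_def] by measurable
  have ip': "integrable ?U (\<lambda>\<omega>. p (?XZ \<omega>))" and iq': "integrable ?U (\<lambda>\<omega>. q (?XZ \<omega>))"
    using integrable_distr[OF XZ ip] integrable_distr[OF XZ iq] by simp_all
  have ih: "integrable ?U (\<lambda>\<omega>. h (?XZ \<omega>))"
    unfolding h_def using ip' iq' by simp

  let ?ind = "indicator {w \<in> space (?C \<Otimes>\<^sub>M ?C). fst w > snd w} :: real \<times> real \<Rightarrow> ennreal"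
  \<comment> \<open>The kernel conditions on both signals, while the payment sees only the second.
    The density of the conditioning on a win becomes a weight depending on \<open>w\<close>
    only.\<close>
  have disint: "(\<integral>\<^sup>+\<omega>. ennreal (k (?XZ \<omega>)) \<partial>?U) =
      (\<integral>\<^sup>+w. (\<integral>\<^sup>+x. ennreal (k (x, snd w)) * (?ind w / emeasure M (buyer1_wins M N Y)) \<partial>K w)
        \<partial>distr M (?C \<Otimes>\<^sub>M ?C) ?W)"
    if k[measurable]: "k \<in> borel_measurable (?A \<Otimes>\<^sub>M ?C)" for k :: "real \<times> real \<Rightarrow> real"
  proof -
    have "(\<integral>\<^sup>+\<omega>. ennreal (k (?XZ \<omega>)) \<partial>?U) =
        (\<integral>\<^sup>+\<omega>. (indicator (buyer1_wins M N Y) \<omega> / emeasure M (buyer1_wins M N Y)) * ennreal (k (?XZ \<omega>)) \<partial>M)"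
      unfolding uniform_measure_def by (rule nn_integral_density) measurable
    also have "\<dots> = (\<integral>\<^sup>+\<omega>. (\<lambda>(x, w). ennreal (k (x, snd w)) * (?ind w / emeasure M (buyer1_wins M N Y)))
        (X 1 \<omega>, ?W \<omega>) \<partial>M)"
      by (rule nn_integral_cong) (auto simp: wins mult.commute split: split_indicator)
    also have "\<dots> = (\<integral>\<^sup>+w. (\<integral>\<^sup>+x. (\<lambda>(x, w). ennreal (k (x, snd w)) *
        (?ind w / emeasure M (buyer1_wins M N Y))) (x, w) \<partial>K w) \<partial>distr M (?C \<Otimes>\<^sub>M ?C) ?W)"
      by (rule nn_integral_regular_cond_distr[OF cond_distr X1 W _ prob_space_axioms]) measurable
    finally show ?thesis by simp
  qed
  \<comment> \<open>The comparison is made pair by pair of signals: losing pairs have weight zero on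
    both sides, and on winning pairs the inequality at fixed signals applies, multiplied by the
    weight.\<close>
  have "(\<integral>\<^sup>+\<omega>. ennreal (- h (?XZ \<omega>)) \<partial>?U) \<le> (\<integral>\<^sup>+\<omega>. ennreal (h (?XZ \<omega>)) \<partial>?U)"
    unfolding disint[OF h] disint[OF borel_measurable_uminus[OF h]]
  proof (rule nn_integral_mono)
    fix w assume "w \<in> space (distr M (?C \<Otimes>\<^sub>M ?C) ?W)"
    then have w: "w \<in> space (?C \<Otimes>\<^sub>M ?C)" by simp
    then obtain y z where yz: "w = (y, z)" "y \<in> {yl..yh}" "z \<in> {yl..yh}" using spW by auto
    show "(\<integral>\<^sup>+x. ennreal (- h (x, snd w)) * (?ind w / emeasure M (buyer1_wins M N Y)) \<partial>K w)
       \<le> (\<integral>\<^sup>+x. ennreal (h (x, snd w)) * (?ind w / emeasure M (buyer1_wins M N Y)) \<partial>K w)"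
    proof (cases "z < y")
      case False
      then show ?thesis using yz by simp
    next
      case True
      have "integrable (K w) (\<lambda>x. h (x, z))" "(\<integral>x. h (x, z) \<partial>K w) \<ge> 0"
        unfolding h_def p_def q_def yz(1) fst_conv snd_conv
        using expected_payment_le[OF Ks value_bounds(2) bids utility(1,2) \<phi>_shape \<phi>_ordering
            \<psi>_ordering steeper mlr yz(2,3)] True by simp_all
      moreover from this have "(\<lambda>x. h (x, z)) \<in> borel_measurable (K w)" by simp
      ultimately show ?thesis
        using yz nn_integral_neg_part_le_iff[of "K w" "\<lambda>x. h (x, z)"]
        by (simp add: nn_integral_multc mult_right_mono)
    qed
  qed
  then have "(\<integral>\<omega>. h (?XZ \<omega>) \<partial>?U) \<ge> 0"
    using nn_integral_neg_part_le_iff[OF ih] by simp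
  then show ?thesis
    using ip' iq' by (simp add: h_def expected_revenue_def p_def q_def)
qed

end
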